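(* Let $0\le k\le d$ be integers. Every finite pure $d$-dimensional simplicial complex $X$ with $\tilde H_k(X)\neq 0$ has at least $\left\lceil \frac{(d+1)(k+2)}{k+1}\right\rceil$ vertices. Moreover, this bound is tight: there exists a pure $d$-dimensional simplicial complex with nontrivial $\tilde H_k$ having exactly $\left\lceil \frac{(d+1)(k+2)}{k+1}\right\rceil$ vertices.
   Context: A simplicial complex is pure $d$-dimensional if every simplex is contained in a $d$-dimensional face (so all maximal faces have dimension $d$). Homology is simplicial homology with coefficients in an arbitrary abelian group; $\tilde H_k$ denotes reduced homology. *)

theory Defs
  imports Complex_Main "HOL-Algebra.FiniteProduct" "HOL-Algebra.Product_Groups"
begin

section \<open>Finite simplicial complexes\<close>

text \<open>
  A complex is the set of its simplices, the empty simplex included. The dimension of a simplex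
  is its cardinality minus one.
\<close>

definition finite_complex :: "'a set set \<Rightarrow> bool" where
  "finite_complex X \<longleftrightarrow>
     finite X \<and> {} \<in> X \<and> (\<forall>\<sigma>\<in>X. finite \<sigma> \<and> (\<forall>\<tau>. \<tau> \<subseteq> \<sigma> \<longrightarrow> \<tau> \<in> X))"

definition pure_dim :: "nat \<Rightarrow> 'a set set \<Rightarrow> bool" where
  "pure_dim d X \<longleftrightarrow> (\<forall>\<sigma>\<in>X. \<exists>\<tau>\<in>X. \<sigma> \<subseteq> \<tau> \<and> card \<tau> = d + 1)"

definition vertices :: "'a set set \<Rightarrow> 'a set" where
  "vertices X = \<Union>X"


section \<open>Reduced simplicial homology with coefficients\<close>

text \<open>
  We use oriented simplicial chains. All groups below are indexed by the number \<open>n\<close> of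
  vertices of a simplex, that is, by its dimension plus one, so that \<open>n = 0\<close> is the degree \<open>-1\<close>
  of the augmented chain complex, whose only generator is the empty simplex.

  A chain with coefficients in \<open>G\<close> (written multiplicatively, as always in HOL-Algebra) is a
  function from ordered simplices to \<open>G\<close> that changes sign when two vertices are interchanged.
  The function \<open>c\<close> stands for the formal sum of the \<open>c [v\<^sub>0,\<dots>,v\<^sub>k] \<cdot> [v\<^sub>0,\<dots>,v\<^sub>k]\<close>
  over all simplices of dimension \<open>k\<close>, each taken once, with an arbitrary order of its vertices.
\<close>

definition ordered_simplices :: "'a set set \<Rightarrow> nat \<Rightarrow> 'a list set" where
  "ordered_simplices X n = {vs. distinct vs \<and> length vs = n \<and> set vs \<in> X}"

definition alternating ::
  "('g, 'm) monoid_scheme \<Rightarrow> 'a set set \<Rightarrow> nat \<Rightarrow> ('a list \<Rightarrow> 'g) \<Rightarrow> bool" where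
  "alternating G X n c \<longleftrightarrow>
     (\<forall>vs \<in> ordered_simplices X n. \<forall>i j. i < j \<and> j < n \<longrightarrow>
        c (vs[i := vs ! j, j := vs ! i]) = inv\<^bsub>G\<^esub> (c vs))"

definition chain_group ::
  "('g, 'm) monoid_scheme \<Rightarrow> 'a set set \<Rightarrow> nat \<Rightarrow> ('a list \<Rightarrow> 'g) monoid" where
  "chain_group G X n =
     (product_group (ordered_simplices X n) (\<lambda>_. G))
       \<lparr>carrier := {c \<in> (\<Pi>\<^sub>E vs \<in> ordered_simplices X n. carrier G). alternating G X n c}\<rparr>"

text \<open>
  The boundary from simplices with \<open>n + 1\<close> vertices to simplices with \<open>n\<close> vertices. The simplices
  having \<open>[w\<^sub>1,\<dots>,w\<^sub>n]\<close> as a facet are the \<open>[v,w\<^sub>1,\<dots>,w\<^sub>n]\<close>; with this order of the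
  vertices the facet occurs with sign \<open>+1\<close> in the usual alternating sum. The lemma
  \<open>boundary_map_elementary\<close> below recovers that alternating sum. For \<open>n = 0\<close> this is the
  augmentation.
\<close>

definition boundary_map ::
  "('g, 'm) monoid_scheme \<Rightarrow> 'a set set \<Rightarrow> nat \<Rightarrow> ('a list \<Rightarrow> 'g) \<Rightarrow> 'a list \<Rightarrow> 'g" where
  "boundary_map G X n c =
     (\<lambda>ws \<in> ordered_simplices X n.
        \<Otimes>\<^bsub>G\<^esub>v\<in>{v. v # ws \<in> ordered_simplices X (Suc n)}. c (v # ws))"

definition cycles ::
  "('g, 'm) monoid_scheme \<Rightarrow> 'a set set \<Rightarrow> nat \<Rightarrow> ('a list \<Rightarrow> 'g) set" where
  "cycles G X k =
     kernel (chain_group G X (Suc k)) (chain_group G X k) (boundary_map G X k)"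

definition boundaries ::
  "('g, 'm) monoid_scheme \<Rightarrow> 'a set set \<Rightarrow> nat \<Rightarrow> ('a list \<Rightarrow> 'g) set" where
  "boundaries G X k =
     boundary_map G X (Suc k) ` carrier (chain_group G X (Suc (Suc k)))"

text \<open>Here the index \<open>k\<close> is the homological degree.\<close>

definition reduced_homology ::
  "('g, 'm) monoid_scheme \<Rightarrow> 'a set set \<Rightarrow> nat \<Rightarrow> ('a list \<Rightarrow> 'g) set monoid" where
  "reduced_homology G X k =
     (chain_group G X (Suc k))\<lparr>carrier := cycles G X k\<rparr> Mod boundaries G X k"


subsection \<open>Comparison with the alternating sum formula\<close>

lemma finite_coface_vertices:
  assumes "finite_complex X"
  shows "finite {v. v # ws \<in> ordered_simplices X n}"
proof (rule finite_subset)
  show "{v. v # ws \<in> ordered_simplices X n} \<subseteq> \<Union>X"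
    by (auto simp: ordered_simplices_def)
  show "finite (\<Union>X)"
    using assms by (auto simp: finite_complex_def)
qed

lemma alternating_move_to_front:
  assumes G: "comm_group G" and c: "c \<in> carrier (chain_group G X n)"
    and vs: "vs \<in> ordered_simplices X n" and i: "i < n"
  shows "c (vs ! i # take i vs @ drop (Suc i) vs) = (if even i then c vs else inv\<^bsub>G\<^esub> (c vs))"
  using vs i
proof (induction i arbitrary: vs)
  case 0
  then show ?case
    by (cases vs) (auto simp: ordered_simplices_def)
next
  case (Suc i)
  interpret comm_group G by (rule G)
  define us where "us = vs[i := vs ! Suc i, Suc i := vs ! i]"
  have len: "length vs = n"
    using Suc.prems by (simp add: ordered_simplices_def)
  have us: "us \<in> ordered_simplices X n"
    using Suc.prems len unfolding us_def ordered_simplices_def by simp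
  have "us ! i # take i us @ drop (Suc i) us = vs ! Suc i # take (Suc i) vs @ drop (Suc (Suc i)) vs"
  proof -
    have "us = take i vs @ [vs ! Suc i, vs ! i] @ drop (Suc (Suc i)) vs"
      using Suc.prems(2) len unfolding us_def
      by (intro nth_equalityI)
         (auto simp: nth_append nth_Cons nth_list_update min_def split: nat.split
           intro!: arg_cong[where f = "(!) vs"])
    then show ?thesis
      using Suc.prems(2) len by (simp add: take_Suc_conv_app_nth min_def nth_append)
  qed
  moreover have "c us = inv\<^bsub>G\<^esub> (c vs)"
    using c Suc.prems unfolding us_def chain_group_def alternating_def by simp
  moreover have "c vs \<in> carrier G"
    using c Suc.prems unfolding chain_group_def by auto
  ultimately show ?case
    using Suc.IH[OF us] Suc.prems(2) by simp
qed

text \<open>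
  A chain supported on the orderings of \<open>[v\<^sub>0,\<dots>,v\<^sub>n]\<close> with value \<open>g\<close> at \<open>[v\<^sub>0,\<dots>,v\<^sub>n]\<close> has as
  boundary the sum over \<open>i\<close> of \<open>(-1)\<^sup>i g\<close> times the simplex with \<open>v\<^sub>i\<close> omitted.
\<close>

lemma boundary_map_elementary:
  assumes G: "comm_group G" and X: "finite_complex X"
    and c: "c \<in> carrier (chain_group G X (Suc n))"
    and vs: "vs \<in> ordered_simplices X (Suc n)"
    and supp: "\<And>us. us \<in> ordered_simplices X (Suc n) \<Longrightarrow> set us \<noteq> set vs \<Longrightarrow> c us = \<one>\<^bsub>G\<^esub>"
  shows "i \<le> n \<Longrightarrow> boundary_map G X n c (take i vs @ drop (Suc i) vs)
            = (if even i then c vs else inv\<^bsub>G\<^esub> (c vs))"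
    and "ws \<in> ordered_simplices X n \<Longrightarrow> \<not> set ws \<subseteq> set vs \<Longrightarrow> boundary_map G X n c ws = \<one>\<^bsub>G\<^esub>"
proof -
  interpret comm_group G by (rule G)
  have cG: "c us \<in> carrier G" if "us \<in> ordered_simplices X (Suc n)" for us
    using c that unfolding chain_group_def by auto
  show "boundary_map G X n c ws = \<one>\<^bsub>G\<^esub>"
    if "ws \<in> ordered_simplices X n" "\<not> set ws \<subseteq> set vs"
  proof -
    have "c (v # ws) = \<one>\<^bsub>G\<^esub>" if "v # ws \<in> ordered_simplices X (Suc n)" for v
      using supp[OF that] \<open>\<not> set ws \<subseteq> set vs\<close> by auto
    then show ?thesis
      using that(1) by (auto simp: boundary_map_def intro!: finprod_one_eqI)
  qed
  show "boundary_map G X n c (take i vs @ drop (Suc i) vs)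
            = (if even i then c vs else inv\<^bsub>G\<^esub> (c vs))" if i: "i \<le> n"
  proof -
    define ws where "ws = take i vs @ drop (Suc i) vs"
    have len: "length vs = Suc n" and dist: "distinct vs" and vsX: "set vs \<in> X"
      using vs by (auto simp: ordered_simplices_def)
    have split: "vs = take i vs @ vs ! i # drop (Suc i) vs"
      using len i by (simp add: id_take_nth_drop)
    have set_vs: "set vs = insert (vs ! i) (set ws)"
      unfolding ws_def by (subst split) auto
    have distws: "distinct (vs ! i # ws)"
      using dist unfolding ws_def by (subst (asm) split) auto
    have lenws: "length ws = n"
      using len i by (simp add: ws_def)
    have ws: "ws \<in> ordered_simplices X n"
      using distws lenws vsX X set_vs
      unfolding ordered_simplices_def finite_complex_def by auto
    have vws: "vs ! i # ws \<in> ordered_simplices X (Suc n)"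
      using distws lenws vsX set_vs unfolding ordered_simplices_def by auto
    define V where "V = {v. v # ws \<in> ordered_simplices X (Suc n)}"
    have fin: "finite V"
      unfolding V_def by (rule finite_coface_vertices[OF X])
    have other: "c (v # ws) = \<one>\<^bsub>G\<^esub>" if "v \<in> V" "v \<noteq> vs ! i" for v
    proof (rule supp)
      show "v # ws \<in> ordered_simplices X (Suc n)"
        using that by (simp add: V_def)
      then have "v \<notin> set ws"
        by (simp add: ordered_simplices_def)
      then show "set (v # ws) \<noteq> set vs"
        using that(2) set_vs by auto
    qed
    have "boundary_map G X n c ws = (\<Otimes>\<^bsub>G\<^esub>v\<in>V. c (v # ws))"
      using ws by (simp add: boundary_map_def V_def)
    also have "\<dots> = (\<Otimes>\<^bsub>G\<^esub>v\<in>V. if vs ! i = v then c (v # ws) else \<one>\<^bsub>G\<^esub>)"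
      using other cG by (intro finprod_cong') (auto simp: V_def)
    also have "\<dots> = c (vs ! i # ws)"
      using fin vws cG by (intro finprod_singleton) (auto simp: V_def)
    also have "\<dots> = (if even i then c vs else inv\<^bsub>G\<^esub> (c vs))"
      using alternating_move_to_front[OF G c vs] i by (simp add: ws_def)
    finally show ?thesis
      by (simp add: ws_def)
  qed
qed

end

theory Submission
  imports Defs
begin

text \<open>
  Lower bound: if \<open>n\<close> is the number of vertices and \<open>n (k + 1) < (d + 1) (k + 2)\<close>, then the
  complements of \<open>k + 2\<close> facets are too small to cover the vertex set, so any \<open>k + 2\<close> facets have a
  common vertex. Adding the facets one at a time, a Mayer-Vietoris argument shows that then every
  \<open>k\<close>-cycle bounds: the intersection of the last facet with the union of the others is covered by
  sets any \<open>k + 1\<close> of which have a common vertex, so its \<open>(k - 1)\<close>-cycles bound.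

  Tightness: on the vertices \<open>0, \<dots>, n - 1\<close> take \<open>k + 2\<close> facets, the \<open>i\<close>-th one containing
  \<open>{0, \<dots>, k + 1} - {i}\<close> and no vertex congruent to \<open>i\<close> modulo \<open>k + 2\<close>. Reduction modulo \<open>k + 2\<close>
  retracts this complex onto the boundary of a \<open>(k + 1)\<close>-simplex. By the lower bound every one of
  the \<open>n\<close> vertices is used.
\<close>

lemma ordered_simplices_swap:
  "us @ a # b # vs \<in> ordered_simplices K n \<longleftrightarrow> us @ b # a # vs \<in> ordered_simplices K n"
  by (auto simp: ordered_simplices_def insert_commute)

context comm_group
begin

section \<open>Finite products in an abelian group\<close>

text \<open>The factors cancel in pairs \<open>s\<close>, \<open>t s\<close>. Fixed points get a
  hypothesis of their own, because \<open>f s = inv (f s)\<close> does not exclude an element of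
  order two.\<close>

lemma finprod_sign_reversing:
  assumes "finite S" and t: "\<And>s. s \<in> S \<Longrightarrow> t s \<in> S" "\<And>s. s \<in> S \<Longrightarrow> t (t s) = s"
    and f: "\<And>s. s \<in> S \<Longrightarrow> f s \<in> carrier G" "\<And>s. s \<in> S \<Longrightarrow> f (t s) = inv (f s)"
    and fixpoint: "\<And>s. s \<in> S \<Longrightarrow> t s = s \<Longrightarrow> f s = \<one>"
  shows "(\<Otimes>s\<in>S. f s) = \<one>"
  using assms
proof (induction "card S" arbitrary: S rule: less_induct)
  case less
  show ?case
  proof (cases "S = {}")
    case False
    then obtain s where s: "s \<in> S" by auto
    define T where "T = S - {s, t s}"
    have "s \<in> {s, t s}" by simp
    then have "card T < card S"
      using s less.prems(1) unfolding T_def by (intro psubset_card_mono) auto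
    moreover have "t u \<in> T" if "u \<in> T" for u
    proof -
      have "t (t u) = u" "t (t s) = s" "t u \<in> S" "u \<noteq> s" "u \<noteq> t s"
        using that less.prems(2,3) s by (auto simp: T_def)
      then have "t u \<noteq> s" "t u \<noteq> t s"
        by auto
      then show ?thesis
        using \<open>t u \<in> S\<close> by (simp add: T_def)
    qed
    ultimately have T: "(\<Otimes>s\<in>T. f s) = \<one>"
      using less.prems by (intro less.hyps) (auto simp: T_def)
    have fT: "f \<in> T \<rightarrow> carrier G" "finite T" and ts: "t s \<in> S"
      using less.prems s by (auto simp: T_def)
    show ?thesis
    proof (cases "t s = s")
      case True
      then have "S = insert s T" "s \<notin> T" using s by (auto simp: T_def)
      then show ?thesis using fT T less.prems(6)[OF s True] by simp
    next
      case False
      then have "S = insert s (insert (t s) T)" "s \<notin> insert (t s) T" "t s \<notin> T"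
        using s ts by (auto simp: T_def)
      then show ?thesis using fT T less.prems(4)[OF s] less.prems(5)[OF s] by simp
    qed
  qed simp
qed

lemma finprod_Sigma:
  assumes "finite I" "\<And>i. i \<in> I \<Longrightarrow> finite (J i)"
    and f: "\<And>i j. i \<in> I \<Longrightarrow> j \<in> J i \<Longrightarrow> f i j \<in> carrier G"
  shows "(\<Otimes>i\<in>I. \<Otimes>j\<in>J i. f i j) = (\<Otimes>p\<in>Sigma I J. f (fst p) (snd p))"
proof -
  have "(\<Otimes>p\<in>(\<Union>i\<in>I. Pair i ` J i). f (fst p) (snd p)) = (\<Otimes>i\<in>I. \<Otimes>p\<in>Pair i ` J i. f (fst p) (snd p))"
    using assms by (intro finprod_UN_disjoint) (auto simp: pairwise_def disjnt_def)
  also have "\<dots> = (\<Otimes>i\<in>I. \<Otimes>j\<in>J i. f i j)"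
  proof (rule finprod_cong')
    show "(\<Otimes>p\<in>Pair i ` J i. f (fst p) (snd p)) = (\<Otimes>j\<in>J i. f i j)" if "i \<in> I" for i
      using f that by (subst finprod_reindex) (auto simp: inj_on_def)
  qed (use f in \<open>auto intro!: finprod_closed\<close>)
  finally show ?thesis
    by (simp add: Sigma_def image_UN UNION_singleton_eq_range)
qed

section \<open>Alternating chains on all lists\<close>

text \<open>
  Chains are extended by \<open>\<one>\<close> to all lists, so that the chains of a subcomplex are literally
  chains of the complex.
\<close>

definition chains :: "'v set set \<Rightarrow> nat \<Rightarrow> ('v list \<Rightarrow> 'a) set" where
  "chains K n = {c. range c \<subseteq> carrier G \<and> (\<forall>vs. vs \<notin> ordered_simplices K n \<longrightarrow> c vs = \<one>) \<and>
     (\<forall>us a b vs. c (us @ a # b # vs) = inv (c (us @ b # a # vs)))}"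

text \<open>Exchanging neighbours does not change whether a list is an ordered simplex. Off the
  ordered simplices both sides of the sign rule are therefore \<open>\<one>\<close>.\<close>

lemma chainsI:
  assumes "\<And>vs. c vs \<in> carrier G"
    and "\<And>vs. vs \<notin> ordered_simplices K n \<Longrightarrow> c vs = \<one>"
    and "\<And>us a b vs. us @ a # b # vs \<in> ordered_simplices K n \<Longrightarrow>
           c (us @ a # b # vs) = inv (c (us @ b # a # vs))"
  shows "c \<in> chains K n"
proof -
  have "c (us @ a # b # vs) = inv (c (us @ b # a # vs))" for us a b vs
    using assms(2,3) ordered_simplices_swap by (metis inv_one)
  then show ?thesis
    using assms(1,2) unfolding chains_def by blast
qed

lemma chains_closed: "c \<in> chains K n \<Longrightarrow> c vs \<in> carrier G"
  unfolding chains_def by blast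

lemma chains_support: "c \<in> chains K n \<Longrightarrow> vs \<notin> ordered_simplices K n \<Longrightarrow> c vs = \<one>"
  unfolding chains_def by blast

lemma chains_swap: "c \<in> chains K n \<Longrightarrow> c (us @ a # b # vs) = inv (c (us @ b # a # vs))"
  unfolding chains_def by blast

text \<open>The hypothesis concerns cardinality \<open>n\<close> alone, so a chain can pass to a
  complex that does not contain \<open>K\<close>. In this way the boundary of a full simplex becomes
  a chain of the complex in \<open>tight_complex\<close>.\<close>

lemma chains_mono:
  assumes c: "c \<in> chains K n" and KL: "\<And>\<sigma>. \<sigma> \<in> K \<Longrightarrow> card \<sigma> = n \<Longrightarrow> \<sigma> \<in> L"
  shows "c \<in> chains L n"
proof (rule chainsI)
  show "c vs = \<one>" if "vs \<notin> ordered_simplices L n" for vs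
    using that KL[of "set vs"]
    by (intro chains_support[OF c]) (auto simp: ordered_simplices_def distinct_card)
qed (use chains_closed[OF c] chains_swap[OF c] in blast)+

lemma chains_one: "(\<lambda>_. \<one>) \<in> chains K n"
  by (simp add: chains_def)

lemma chains_mult:
  assumes c: "c \<in> chains K n" and c': "c' \<in> chains K n"
  shows "(\<lambda>vs. c vs \<otimes> c' vs) \<in> chains K n"
proof (rule chainsI)
  show "c vs \<otimes> c' vs = \<one>" if "vs \<notin> ordered_simplices K n" for vs
    by (simp add: chains_support[OF c that] chains_support[OF c' that])
  show "c (us @ a # b # vs) \<otimes> c' (us @ a # b # vs)
      = inv (c (us @ b # a # vs) \<otimes> c' (us @ b # a # vs))" for us a b vs
    unfolding chains_swap[OF c, of us a] chains_swap[OF c', of us a]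
    by (simp add: inv_mult chains_closed[OF c] chains_closed[OF c'])
qed (simp add: chains_closed[OF c] chains_closed[OF c'])

lemma chains_inv:
  assumes c: "c \<in> chains K n"
  shows "(\<lambda>vs. inv (c vs)) \<in> chains K n"
proof (rule chainsI)
  show "inv (c vs) = \<one>" if "vs \<notin> ordered_simplices K n" for vs
    by (simp add: chains_support[OF c that])
  show "inv (c (us @ a # b # vs)) = inv (inv (c (us @ b # a # vs)))" for us a b vs
    by (simp only: chains_swap[OF c, of us a b vs])
qed (simp add: chains_closed[OF c])

text \<open>Recovers the sign rule of \<open>alternating\<close> from exchanges of neighbours. Each
  \<open>m\<close> between \<open>a\<close> and \<open>b\<close> is passed by both of them, so its
  two signs cancel.\<close>

lemma chains_transpose:
  assumes "c \<in> chains K n"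
  shows "c (us @ a # ms @ b # vs) = inv (c (us @ b # ms @ a # vs))"
proof (induction ms arbitrary: us)
  case Nil
  show ?case using chains_swap[OF assms, of us a b vs] by simp
next
  case (Cons m ms)
  have "c (us @ a # (m # ms) @ b # vs) = inv (c ((us @ [m]) @ a # ms @ b # vs))"
    using chains_swap[OF assms, of us a m] by simp
  also have "\<dots> = c (us @ m # b # ms @ a # vs)"
    unfolding Cons.IH by (simp add: chains_closed[OF assms])
  also have "\<dots> = inv (c (us @ b # (m # ms) @ a # vs))"
    using chains_swap[OF assms, of us m b] by simp
  finally show ?case .
qed

lemma chains_move_front:
  assumes c: "c \<in> chains K n"
  shows "c (us @ x # vs) = (if even (length us) then c (x # us @ vs) else inv (c (x # us @ vs)))"
proof (induction us arbitrary: vs rule: rev_induct)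
  case (snoc u us)
  then show ?case
    using chains_swap[OF c, of us u x vs] chains_closed[OF c] by simp
qed simp

section \<open>The boundary operator\<close>

text \<open>The index set \<open>V\<close> is fixed, unlike in \<open>boundary_map\<close>: a chain
  is \<open>\<one>\<close> at every \<open>v # ws\<close> that is not an ordered simplex. Hence one
  operator serves all degrees and all subcomplexes.\<close>

definition bd :: "'v set \<Rightarrow> ('v list \<Rightarrow> 'a) \<Rightarrow> 'v list \<Rightarrow> 'a" where
  "bd V c ws = (\<Otimes>v\<in>V. c (v # ws))"

lemma bd_mult:
  "c \<in> chains K n \<Longrightarrow> c' \<in> chains L m \<Longrightarrow> bd V (\<lambda>vs. c vs \<otimes> c' vs) ws = bd V c ws \<otimes> bd V c' ws"
  unfolding bd_def by (rule finprod_multf) (auto intro: chains_closed)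

lemma bd_closed: "c \<in> chains K n \<Longrightarrow> bd V c ws \<in> carrier G"
  unfolding bd_def by (rule finprod_closed) (auto intro: chains_closed)

lemma bd_inv:
  assumes c: "c \<in> chains K n"
  shows "bd V (\<lambda>vs. inv (c vs)) ws = inv (bd V c ws)"
proof -
  have "bd V (\<lambda>vs. inv (c vs)) ws \<otimes> bd V c ws = \<one>"
    unfolding bd_mult[OF chains_inv[OF c] c, symmetric] by (simp add: bd_def chains_closed[OF c])
  then show ?thesis
    using bd_closed[OF c] bd_closed[OF chains_inv[OF c]] by (metis inv_equality)
qed

lemma bd_chains:
  assumes c: "c \<in> chains K (Suc n)" and K: "\<And>\<sigma> \<tau>. \<sigma> \<in> K \<Longrightarrow> \<tau> \<subseteq> \<sigma> \<Longrightarrow> \<tau> \<in> K"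
  shows "bd V c \<in> chains K n"
proof (rule chainsI)
  show "bd V c ws = \<one>" if "ws \<notin> ordered_simplices K n" for ws
  proof -
    have "v # ws \<notin> ordered_simplices K (Suc n)" for v
      using that K[of "set (v # ws)" "set ws"] by (auto simp: ordered_simplices_def)
    then have "c (v # ws) = \<one>" for v
      using chains_support[OF c] by blast
    then show ?thesis
      by (simp add: bd_def)
  qed
  show "bd V c (us @ a # b # vs) = inv (bd V c (us @ b # a # vs))" for us a b vs
  proof -
    have "c (v # us @ a # b # vs) = inv (c (v # us @ b # a # vs))" for v
      using chains_swap[OF c, of "v # us" a b vs] by simp
    then show ?thesis
      using bd_inv[OF c, of V] by (simp add: bd_def)
  qed
qed (simp add: chains_closed[OF c] bd_closed[OF c])

text \<open>Swapping the two prepended vertices is a sign-reversing involution of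
  \<open>V \<times> V\<close>. On the diagonal the list has a repeated entry, so \<open>c\<close> is
  \<open>\<one>\<close> there.\<close>

lemma bd_bd:
  fixes c :: "'v list \<Rightarrow> 'a"
  assumes c: "c \<in> chains K n" and V: "finite V"
  shows "bd V (bd V c) ws = \<one>"
proof -
  have "bd V (bd V c) ws = (\<Otimes>p\<in>V \<times> V. c (snd p # fst p # ws))"
    unfolding bd_def
    using finprod_Sigma[of V "\<lambda>_. V" "\<lambda>u v. c (v # u # ws)"] V chains_closed[OF c] by simp
  also have "\<dots> = \<one>"
  proof (rule finprod_sign_reversing[where t = prod.swap])
    fix p :: "'v \<times> 'v"
    obtain u v where p: "p = (u, v)"
      by fastforce
    show "c (snd (prod.swap p) # fst (prod.swap p) # ws) = inv (c (snd p # fst p # ws))"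
      unfolding p using chains_swap[OF c, of "[]" u v ws] by simp
    show "c (snd p # fst p # ws) = \<one>" if "prod.swap p = p"
    proof (rule chains_support[OF c])
      have "fst p = snd p"
        using that by (metis fst_swap)
      then show "snd p # fst p # ws \<notin> ordered_simplices K n"
        by (simp add: ordered_simplices_def)
    qed
  qed (use chains_closed[OF c] V in \<open>auto simp: prod_eq_iff\<close>)
  finally show ?thesis .
qed

section \<open>Cones\<close>

text \<open>The join of \<open>x\<close> with \<open>c\<close>: its value at \<open>x # ws\<close>
  is \<open>c ws\<close> when \<open>x # ws\<close> is distinct, and each vertex standing before
  \<open>x\<close> contributes a sign. Simplices of \<open>c\<close> that already contain
  \<open>x\<close> are dropped.\<close>

definition cone :: "'v \<Rightarrow> ('v list \<Rightarrow> 'a) \<Rightarrow> 'v list \<Rightarrow> 'a" where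
  "cone x c vs =
     (if distinct vs \<and> x \<in> set vs
      then if even (length (takeWhile (\<lambda>y. y \<noteq> x) vs)) then c (remove1 x vs) else inv (c (remove1 x vs))
      else \<one>)"

lemma cone_eq:
  assumes "distinct (us @ x # vs)"
  shows "cone x c (us @ x # vs) = (if even (length us) then c (us @ vs) else inv (c (us @ vs)))"
proof -
  have "takeWhile (\<lambda>y. y \<noteq> x) (us @ x # vs) = us"
    using assms by (auto simp: takeWhile_append)
  moreover have "remove1 x (us @ x # vs) = us @ vs"
    using assms by (simp add: remove1_append)
  ultimately show ?thesis
    using assms by (simp add: cone_def)
qed

lemma cone_chains:
  assumes c: "c \<in> chains K n" and KL: "\<And>\<sigma>. \<sigma> \<in> K \<Longrightarrow> insert x \<sigma> \<in> L"
  shows "cone x c \<in> chains L (Suc n)"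
proof (rule chainsI)
  show "cone x c vs \<in> carrier G" for vs
    by (simp add: cone_def chains_closed[OF c])
  show "cone x c vs = \<one>" if "vs \<notin> ordered_simplices L (Suc n)" for vs
  proof (cases "distinct vs \<and> x \<in> set vs")
    case True
    have "remove1 x vs \<notin> ordered_simplices K n"
    proof
      assume *: "remove1 x vs \<in> ordered_simplices K n"
      have "insert x (set (remove1 x vs)) = set vs"
        using True by (auto simp: set_remove1_eq)
      then have "set vs \<in> L"
        using * KL[of "set (remove1 x vs)"] by (simp add: ordered_simplices_def)
      moreover have "length vs = Suc n"
        using * True Suc_pred[OF length_pos_if_in_set[of x vs]]
        by (simp add: ordered_simplices_def length_remove1)
      ultimately show False
        using that True by (simp add: ordered_simplices_def)
    qed
    then show ?thesis
      by (simp add: cone_def chains_support[OF c])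
  qed (auto simp: cone_def)
  show "cone x c (us @ a # b # vs) = inv (cone x c (us @ b # a # vs))"
    if "us @ a # b # vs \<in> ordered_simplices L (Suc n)" for us a b vs
  proof -
    have dist: "distinct (us @ a # b # vs)" "distinct (us @ b # a # vs)"
      using that by (auto simp: ordered_simplices_def)
    consider "x \<notin> set (us @ a # b # vs)" | "x \<in> set us" | "x = a" | "x = b" | "x \<in> set vs"
      by auto
    then show ?thesis
    proof cases
      case 1
      then show ?thesis by (simp add: cone_def)
    next
      case 2
      then obtain us1 us2 where us: "us = us1 @ x # us2"
        by (meson split_list)
      show ?thesis
        using cone_eq[of us1 x "us2 @ a # b # vs" c] cone_eq[of us1 x "us2 @ b # a # vs" c]
          dist chains_closed[OF c] chains_swap[OF c, of "us1 @ us2" a b vs]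
        by (simp add: us)
    next
      \<comment> \<open>Here the exchange moves \<open>x\<close> itself: the list without
        \<open>x\<close> stays the same, and the parity of the position of \<open>x\<close>
        changes.\<close>
      case 3
      then show ?thesis
        using cone_eq[of us x "b # vs" c] cone_eq[of "us @ [b]" x vs c] dist chains_closed[OF c] by simp
    next
      case 4
      then show ?thesis
        using cone_eq[of us x "a # vs" c] cone_eq[of "us @ [a]" x vs c] dist chains_closed[OF c] by simp
    next
      case 5
      then obtain vs1 vs2 where vs: "vs = vs1 @ x # vs2"
        by (meson split_list)
      show ?thesis
        using cone_eq[of "us @ a # b # vs1" x vs2 c] cone_eq[of "us @ b # a # vs1" x vs2 c]
          dist chains_closed[OF c] chains_swap[OF c, of us a b "vs1 @ vs2"]
        by (simp add: vs)
    qed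
  qed
qed

text \<open>The homotopy formula, boundary of \<open>x * c\<close> equals \<open>c\<close> minus
  \<open>x * (boundary of c)\<close>, for a cycle \<open>c\<close>. On lists without
  \<open>x\<close> only \<open>v = x\<close> contributes; on lists with \<open>x\<close> the cycle
  condition is used at the list without \<open>x\<close>.\<close>

lemma bd_cone:
  assumes c: "c \<in> chains K n" and V: "finite V" "x \<in> V" and cyc: "bd V c = (\<lambda>_. \<one>)"
  shows "bd V (cone x c) = c"
proof
  fix ws
  have C: "cone x c \<in> chains UNIV (Suc n)"
    by (rule cone_chains[OF c]) simp
  note closed = chains_closed[OF c] chains_closed[OF C]
  have nd: "c vs = \<one>" if "\<not> distinct vs" for vs
    using that by (intro chains_support[OF c]) (simp add: ordered_simplices_def)
  have V': "insert x (V - {x}) = V" "finite (V - {x})" "x \<notin> V - {x}"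
    using V by auto
  consider "\<not> distinct ws" | "distinct ws" "x \<notin> set ws" | "distinct ws" "x \<in> set ws"
    by auto
  then show "bd V (cone x c) ws = c ws"
  proof cases
    case 1
    then show ?thesis by (simp add: bd_def cone_def nd)
  next
    case 2
    have "(\<Otimes>v\<in>V. cone x c (v # ws)) = (\<Otimes>v\<in>insert x (V - {x}). cone x c (v # ws))"
      by (simp only: V'(1))
    also have "\<dots> = cone x c (x # ws) \<otimes> (\<Otimes>v\<in>V - {x}. cone x c (v # ws))"
      using V'(2,3) closed by (intro finprod_insert) auto
    also have "(\<Otimes>v\<in>V - {x}. cone x c (v # ws)) = \<one>"
      using 2 by (intro finprod_one_eqI) (auto simp: cone_def)
    finally show ?thesis
      using 2 cone_eq[of "[]" x ws c] chains_closed[OF c] by (simp add: bd_def)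
  next
    case 3
    then obtain us vs where ws: "ws = us @ x # vs"
      by (meson split_list)
    have dist: "distinct (us @ x # vs)"
      using 3 ws by simp
    \<comment> \<open>The sign of moving \<open>x\<close> to the front of \<open>ws\<close>. In
      \<open>v # ws\<close> the vertex \<open>x\<close> stands one place later, hence the inverse in
      \<open>cone\<close> below.\<close>
    define s where "s g = (if even (length us) then g else inv g)" for g
    have s: "s g \<in> carrier G" "inv (s g) = s (inv g)" if "g \<in> carrier G" for g
      using that by (auto simp: s_def)
    have cone: "cone x c (v # ws) = inv (s (c (v # us @ vs)))" if "v \<noteq> x" for v
    proof (cases "distinct (v # us @ x # vs)")
      case True
      then show ?thesis
        using cone_eq[of "v # us" x vs c] closed by (simp add: ws s_def)
    next
      case False
      then have "\<not> distinct (v # us @ vs)"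
        using dist that by auto
      then have "s (c (v # us @ vs)) = \<one>"
        using nd[of "v # us @ vs"] by (simp add: s_def)
      moreover have "cone x c (v # ws) = \<one>"
        unfolding ws cone_def using False by (simp only: simp_thms if_False)
      ultimately show ?thesis
        by simp
    qed
    have c_ws: "c ws = s (c (x # us @ vs))"
      using chains_move_front[OF c] by (simp add: ws s_def)
    have sum: "(\<Otimes>v\<in>V. s (c (v # us @ vs))) = \<one>"
    proof -
      have "bd V (\<lambda>vs. s (c vs)) (us @ vs) = \<one>"
        using cyc bd_inv[OF c, of V]
        by (cases "even (length us)") (simp_all add: s_def fun_eq_iff)
      then show ?thesis
        by (simp only: bd_def)
    qed
    have "\<one> = (\<Otimes>v\<in>insert x (V - {x}). s (c (v # us @ vs)))"
      unfolding V'(1) by (rule sum[symmetric])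
    also have "\<dots> = c ws \<otimes> (\<Otimes>v\<in>V - {x}. s (c (v # us @ vs)))"
      using V'(2,3) s closed by (subst finprod_insert) (auto simp: c_ws)
    finally have 1: "c ws \<otimes> (\<Otimes>v\<in>V - {x}. s (c (v # us @ vs))) = \<one>" by simp
    have "bd V (cone x c) ws = (\<Otimes>v\<in>insert x (V - {x}). cone x c (v # ws))"
      by (simp only: V'(1) bd_def)
    also have "\<dots> = (\<Otimes>v\<in>V - {x}. cone x c (v # ws))"
      using V'(2,3) closed by (subst finprod_insert) (auto simp: ws cone_def[of x c "x # us @ x # vs"])
    finally have 2: "bd V (cone x c) ws = (\<Otimes>v\<in>V - {x}. cone x c (v # ws))" .
    \<comment> \<open>Both \<open>c ws\<close> and \<open>bd V (cone x c) ws\<close> are inverse to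
      the product over \<open>V - {x}\<close>: the first by the cycle condition at
      \<open>us @ vs\<close>, the second term by term.\<close>
    have "bd V (cone x c) ws \<otimes> (\<Otimes>v\<in>V - {x}. s (c (v # us @ vs))) =
        (\<Otimes>v\<in>V - {x}. cone x c (v # ws) \<otimes> s (c (v # us @ vs)))"
      unfolding 2 using s closed by (subst finprod_multf) auto
    also have "\<dots> = \<one>"
      using cone s(1) closed by (intro finprod_one_eqI) auto
    finally have "bd V (cone x c) ws \<otimes> (\<Otimes>v\<in>V - {x}. s (c (v # us @ vs))) = \<one>" .
    moreover have "(\<Otimes>v\<in>V - {x}. s (c (v # us @ vs))) \<in> carrier G"
      using s closed by (intro finprod_closed) auto
    ultimately show ?thesis
      using 1 closed bd_closed[OF C] by (metis right_cancel)
  qed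
qed

section \<open>Acyclicity of unions of simplices\<close>

text \<open>A full simplex is a cone over any of its vertices.\<close>

lemma simplex_acyclic:
  assumes "z \<in> chains (Pow A) n" "bd V z = (\<lambda>_. \<one>)" "A \<noteq> {}" "A \<subseteq> V" "finite V"
  shows "\<exists>p\<in>chains (Pow A) (Suc n). bd V p = z"
proof -
  obtain x where "x \<in> A"
    using assms by auto
  then show ?thesis
    using assms by (intro bexI[of _ "cone x z"] bd_cone cone_chains) auto
qed

text \<open>Since \<open>n\<close> counts vertices, \<open>z\<close> has degree
  \<open>n - 1\<close>. The induction on \<open>I\<close> keeps \<open>F\<close> and
  \<open>n\<close> arbitrary, because it is used for \<open>F\<close> and also for the traces
  \<open>F i \<inter> F j\<close>. Passing to the traces lowers by one both the degree and the
  number of sets required to meet.\<close>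

lemma acyclic_if_intersecting:
  assumes "finite I" "I \<noteq> {}" and V: "finite V" "\<And>i. i \<in> I \<Longrightarrow> F i \<subseteq> V"
    and "\<And>S. S \<subseteq> I \<Longrightarrow> S \<noteq> {} \<Longrightarrow> card S \<le> Suc n \<Longrightarrow> (\<Inter>i\<in>S. F i) \<noteq> {}"
    and "z \<in> chains (\<Union>i\<in>I. Pow (F i)) n" "bd V z = (\<lambda>_. \<one>)"
  shows "\<exists>p\<in>chains (\<Union>i\<in>I. Pow (F i)) (Suc n). bd V p = z"
  using assms(1,2,4-)
proof (induction I arbitrary: F n z rule: finite_ne_induct)
  case (singleton i)
  then show ?case
    using simplex_acyclic[of z "F i" n V] V(1) singleton.prems(2)[of "{i}"] by simp
next
  case (insert j I)
  define K where "K = (\<Union>i\<in>I. Pow (F i))"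
  define L where "L = (\<Union>i\<in>I. Pow (F i \<inter> F j))"
  have KL: "L = K \<inter> Pow (F j)" "(\<Union>i\<in>insert j I. Pow (F i)) = Pow (F j) \<union> K"
    by (auto simp: K_def L_def)
  have sub: "c \<in> chains (Pow (F j) \<union> K) m" if "c \<in> chains K m \<or> c \<in> chains (Pow (F j)) m" for c m
    using that by (auto intro: chains_mono)
  have IH_K: "\<exists>p\<in>chains K (Suc n). bd V p = c" if "c \<in> chains K n" "bd V c = (\<lambda>_. \<one>)" for c
    unfolding K_def
  proof (rule insert.IH)
    show "(\<Inter>i\<in>S. F i) \<noteq> {}" if "S \<subseteq> I" "S \<noteq> {}" "card S \<le> Suc n" for S
      using that by (intro insert.prems(2)) auto
  qed (use that insert.prems in \<open>auto simp: K_def\<close>)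
  note z = insert.prems(3)[unfolded KL]
  show ?case
  proof (cases n)
    \<comment> \<open>Degree -1: the only simplex is the empty one, which lies in \<open>K\<close>,
      so the induction hypothesis for \<open>K\<close> applies to \<open>z\<close> itself.\<close>
    case 0
    have "{} \<in> K"
      using insert.hyps by (auto simp: K_def)
    then have "z \<in> chains K n"
    proof (intro chains_mono[OF z])
      fix \<sigma> assume "\<sigma> \<in> Pow (F j) \<union> K" "card \<sigma> = n"
      \<comment> \<open>Infinite sets also have \<open>card\<close> zero, so finiteness has to come
        from \<open>V\<close>.\<close>
      moreover have "F i \<subseteq> V" if "i \<in> insert j I" for i
        using insert.prems(1) that by blast
      ultimately have "\<sigma> \<subseteq> V"
        by (auto simp: K_def)
      then have "finite \<sigma>"
        using V(1) finite_subset by blast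
      then show "\<sigma> \<in> K"
        using \<open>{} \<in> K\<close> \<open>card \<sigma> = n\<close> 0 by simp
    qed
    then show ?thesis
      using IH_K insert.prems(4) sub unfolding KL by blast
  next
    case (Suc m)
    have K_down: "\<sigma> \<in> K \<Longrightarrow> \<tau> \<subseteq> \<sigma> \<Longrightarrow> \<tau> \<in> K" for \<sigma> \<tau>
      by (auto simp: K_def)
    have IH_L: "\<exists>p\<in>chains L n. bd V p = c" if "c \<in> chains L m" "bd V c = (\<lambda>_. \<one>)" for c
      unfolding L_def Suc
    proof (rule insert.IH)
      show "(\<Inter>i\<in>S. F i \<inter> F j) \<noteq> {}" if "S \<subseteq> I" "S \<noteq> {}" "card S \<le> Suc m" for S
      proof -
        have "finite S"
          using that insert.hyps finite_subset by blast
        \<comment> \<open>\<open>F j\<close> counts as one of the at most \<open>Suc n\<close> sets,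
          which leaves \<open>Suc m\<close> for \<open>S\<close>.\<close>
        then have "(\<Inter>i\<in>insert j S. F i) \<noteq> {}"
          using that Suc by (intro insert.prems(2)) (auto simp: card_insert_if)
        then show ?thesis
          by auto
      qed
    qed (use that insert.prems in \<open>auto simp: L_def\<close>)
    note zG = chains_closed[OF z]
    \<comment> \<open>The Mayer-Vietoris splitting: \<open>a\<close> is the part of \<open>z\<close>
      on \<open>K\<close>, and the rest \<open>b\<close> lives on the simplex
      \<open>F j\<close>.\<close>
    define a where "a vs = (if set vs \<in> K then z vs else \<one>)" for vs
    define b where "b vs = (if set vs \<in> K then \<one> else z vs)" for vs
    have a: "a \<in> chains K n"
    proof (rule chainsI)
      show "a vs = \<one>" if "vs \<notin> ordered_simplices K n" for vs
        using that chains_support[OF z, of vs] by (auto simp: a_def ordered_simplices_def)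
      show "a (us @ c # d # vs) = inv (a (us @ d # c # vs))" for us c d vs
        using chains_swap[OF z, of us c d vs] by (simp add: a_def insert_commute)
    qed (simp add: a_def zG)
    have b: "b \<in> chains (Pow (F j)) n"
    proof (rule chainsI)
      show "b vs = \<one>" if "vs \<notin> ordered_simplices (Pow (F j)) n" for vs
        using that chains_support[OF z, of vs] by (auto simp: b_def ordered_simplices_def)
      show "b (us @ c # d # vs) = inv (b (us @ d # c # vs))" for us c d vs
        using chains_swap[OF z, of us c d vs] by (simp add: b_def insert_commute)
    qed (simp add: b_def zG)
    have z_ab: "z = (\<lambda>vs. a vs \<otimes> b vs)"
      by (auto simp: a_def b_def zG)
    have bd_ab: "bd V a ws \<otimes> bd V b ws = \<one>" for ws
      using bd_mult[OF a b, of V ws] insert.prems(4) z_ab by metis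
    have bd_a: "bd V a \<in> chains K m"
      using bd_chains a K_down unfolding Suc by blast
    have bd_b: "bd V b \<in> chains (Pow (F j)) m"
      using b unfolding Suc by (rule bd_chains) auto
    \<comment> \<open>As the inverse of \<open>bd V b\<close>, this boundary is supported on
      \<open>K\<close> and on \<open>Pow (F j)\<close>, hence on \<open>L\<close>.\<close>
    have "bd V a \<in> chains L m"
    proof (rule chainsI)
      show "bd V a ws = \<one>" if "ws \<notin> ordered_simplices L m" for ws
      proof (cases "ws \<in> ordered_simplices K m")
        case True
        then have "ws \<notin> ordered_simplices (Pow (F j)) m"
          using that by (auto simp: KL ordered_simplices_def)
        then show ?thesis
          using bd_ab[of ws] chains_support[OF bd_b] chains_closed[OF bd_a] by simp
      qed (use chains_support[OF bd_a] in auto)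
    qed (use chains_closed[OF bd_a] chains_swap[OF bd_a] in blast)+
    \<comment> \<open>A filling inside the intersection. Dividing \<open>a\<close> by
      \<open>e\<close> and multiplying \<open>b\<close> by \<open>e\<close> leaves the product
      \<open>z\<close> unchanged and makes both factors cycles, each of which bounds on its own
      side.\<close>
    then obtain e where e: "e \<in> chains L n" and bd_e: "bd V e = bd V a"
      using IH_L bd_bd[OF a V(1)] by blast
    have eK: "e \<in> chains K n" and eF: "e \<in> chains (Pow (F j)) n"
      using e by (auto simp: KL intro: chains_mono)
    have "bd V (\<lambda>vs. a vs \<otimes> inv (e vs)) = (\<lambda>_. \<one>)"
      using bd_mult[OF a chains_inv[OF eK], of V] bd_inv[OF eK, of V] bd_closed[OF a, of V] bd_e
      by (simp add: fun_eq_iff)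
    then obtain p where p: "p \<in> chains K (Suc n)" "bd V p = (\<lambda>vs. a vs \<otimes> inv (e vs))"
      using IH_K chains_mult[OF a chains_inv[OF eK]] by blast
    have "bd V (\<lambda>vs. e vs \<otimes> b vs) = (\<lambda>_. \<one>)"
      using bd_mult[OF eF b, of V] bd_ab bd_e by (simp add: fun_eq_iff)
    moreover have "F j \<noteq> {}" "F j \<subseteq> V"
      using insert.prems(1)[of j] insert.prems(2)[of "{j}"] by auto
    ultimately obtain q where q: "q \<in> chains (Pow (F j)) (Suc n)" "bd V q = (\<lambda>vs. e vs \<otimes> b vs)"
      using simplex_acyclic[OF chains_mult[OF eF b]] V(1) by blast
    have "bd V (\<lambda>vs. p vs \<otimes> q vs) ws = z ws" for ws
    proof -
      have "bd V (\<lambda>vs. p vs \<otimes> q vs) ws = (a ws \<otimes> inv (e ws)) \<otimes> (e ws \<otimes> b ws)"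
        using bd_mult[OF p(1) q(1)] p(2) q(2) by simp
      also have "\<dots> = a ws \<otimes> (inv (e ws) \<otimes> e ws) \<otimes> b ws"
        by (simp only: m_assoc m_closed inv_closed
            chains_closed[OF a] chains_closed[OF b] chains_closed[OF e])
      finally show ?thesis
        using chains_closed[OF a] chains_closed[OF b] chains_closed[OF e] z_ab by (metis l_inv r_one)
    qed
    then show ?thesis
      unfolding KL using chains_mult[OF sub sub] p(1) q(1) by blast
  qed
qed

section \<open>Detecting a cycle by a retraction\<close>

text \<open>Coning successively over the vertices, from the value \<open>g\<close> at the empty
  list, supplies all orderings with the right signs.\<close>

lemma elementary_chain:
  assumes "distinct xs" "g \<in> carrier G"
  shows "\<exists>e\<in>chains (Pow (set xs)) (length xs). e xs = g"
  using assms
proof (induction xs)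
  case Nil
  have "(\<lambda>vs. if vs = [] then g else \<one>) \<in> chains (Pow {}) 0"
    using Nil by (intro chainsI) (auto simp: ordered_simplices_def)
  then show ?case
    by (intro bexI) auto
next
  case (Cons x xs)
  then obtain e where e: "e \<in> chains (Pow (set xs)) (length xs)" "e xs = g"
    by auto
  have "cone x e \<in> chains (Pow (set (x # xs))) (Suc (length xs))"
    by (rule cone_chains[OF e(1)]) auto
  moreover have "cone x e (x # xs) = g"
    using cone_eq[of "[]" x xs e] Cons.prems e(2) by simp
  ultimately show ?case
    by auto
qed

text \<open>
  The product of the values of a chain over the lists that the retraction \<open>r\<close> maps to \<open>ys\<close> is the
  coefficient of \<open>ys\<close> in the image of the chain under \<open>r\<close>. It is trivial on boundaries from \<open>K\<close>,
  because \<open>r\<close> sends no simplex of \<open>K\<close> onto the whole of \<open>y # ys\<close>.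
\<close>

lemma simplex_boundary_not_bounding:
  assumes V: "finite V" "set (y # ys) \<subseteq> V" and dist: "distinct (y # ys)"
    and r: "r ` V \<subseteq> set (y # ys)" "\<And>x. x \<in> set (y # ys) \<Longrightarrow> r x = x"
    and K: "\<And>\<sigma>. \<sigma> \<in> K \<Longrightarrow> \<not> set (y # ys) \<subseteq> r ` \<sigma>"
    and e: "e \<in> chains (Pow (set (y # ys))) (Suc (length ys))" and e1: "e (y # ys) \<noteq> \<one>"
    and p: "p \<in> chains K (Suc (length ys))"
  shows "bd V p \<noteq> bd V e"
proof
  assume eq: "bd V p = bd V e"
  define S where "S = {vs. set vs \<subseteq> V \<and> map r vs = ys}"
  have "S \<subseteq> {vs. set vs \<subseteq> V \<and> length vs = length ys}"
    by (auto simp: S_def)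
  then have finS: "finite S"
    using finite_lists_length_eq[OF V(1)] finite_subset by blast
  have ysS: "ys \<in> S"
    using V r by (auto simp: S_def intro: map_idI)
  have "bd V e ys = e (y # ys)"
  proof -
    have "(\<Otimes>v\<in>V. e (v # ys)) = (\<Otimes>v\<in>V. if y = v then e (v # ys) else \<one>)"
      using dist chains_closed[OF e]
      by (intro finprod_cong') (auto simp: ordered_simplices_def intro!: chains_support[OF e])
    also have "\<dots> = e (y # ys)"
      using V chains_closed[OF e] by (intro finprod_singleton) auto
    finally show ?thesis
      by (simp add: bd_def)
  qed
  moreover have "bd V e vs = \<one>" if "vs \<in> S" "vs \<noteq> ys" for vs
  proof -
    \<comment> \<open>\<open>r\<close> fixes the vertices of the simplex, so \<open>ys\<close> is
      the only list over them that \<open>r\<close> maps to \<open>ys\<close>.\<close>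
    have "\<not> set vs \<subseteq> set (y # ys)"
    proof
      assume "set vs \<subseteq> set (y # ys)"
      then have "map r vs = vs"
        using r by (intro map_idI) auto
      then show False
        using that by (simp add: S_def)
    qed
    then have "e (v # vs) = \<one>" for v
      by (intro chains_support[OF e]) (auto simp: ordered_simplices_def)
    then show ?thesis
      by (simp add: bd_def)
  qed
  ultimately have "(\<Otimes>vs\<in>S. bd V e vs) = (\<Otimes>vs\<in>S. if ys = vs then e (y # vs) else \<one>)"
    using chains_closed[OF e] by (intro finprod_cong') auto
  also have "\<dots> = e (y # ys)"
    using ysS finS chains_closed[OF e] by (intro finprod_singleton) auto
  finally have val_e: "(\<Otimes>vs\<in>S. bd V e vs) = e (y # ys)" .
  define idx where "idx w = (SOME j. j < length ys \<and> ys ! j = w)" for w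
  have idx: "idx w < length ys" "ys ! idx w = w" if "w \<in> set ys" for w
    using someI_ex[of "\<lambda>j. j < length ys \<and> ys ! j = w"] that
    by (auto simp: idx_def in_set_conv_nth)
  \<comment> \<open>If \<open>r v\<close> lies in \<open>ys\<close>, then \<open>v\<close> is
    exchanged with the entry of the list that has the same image; this preserves \<open>S\<close>
    and reverses the sign of \<open>p\<close>, and at a fixed point \<open>v\<close> is repeated.
    Otherwise \<open>r v = y\<close>, and \<open>v # vs\<close> covers the whole simplex, so
    \<open>p\<close> is \<open>\<one>\<close> there.\<close>
  define t where "t q = (if r (snd q) \<in> set ys
      then ((fst q)[idx (r (snd q)) := snd q], fst q ! idx (r (snd q))) else q)" for q
  have "(\<Otimes>vs\<in>S. bd V p vs) = (\<Otimes>q\<in>S \<times> V. p (snd q # fst q))"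
    unfolding bd_def
    using finprod_Sigma[of S "\<lambda>_. V" "\<lambda>vs v. p (v # vs)"] finS V chains_closed[OF p] by simp
  also have "\<dots> = \<one>"
  proof (rule finprod_sign_reversing[where t = t])
    fix q assume q: "q \<in> S \<times> V"
    obtain vs v where [simp]: "q = (vs, v)"
      by (cases q)
    have vs: "set vs \<subseteq> V" "map r vs = ys" "length vs = length ys" and v: "v \<in> V"
      using q by (auto simp: S_def)
    define j where "j = idx (r v)"
    have "t q \<in> S \<times> V \<and> t (t q) = q \<and> p (snd (t q) # fst (t q)) = inv (p (snd q # fst q))
        \<and> (t q = q \<longrightarrow> p (snd q # fst q) = \<one>)"
    proof (cases "r v \<in> set ys")
      case True
      then have j: "j < length vs" "ys ! j = r v"
        using idx vs by (auto simp: j_def)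
      have tq: "t (vs, v) = (vs[j := v], vs ! j)"
        using True by (simp add: t_def j_def)
      have r_vj: "r (vs ! j) = r v"
        using j vs by (metis nth_map)
      have "map r (vs[j := v]) = ys"
        using j vs by (metis list_update_id map_update)
      moreover have "set (vs[j := v]) \<subseteq> V" "vs ! j \<in> V"
        using vs v j set_update_subset_insert[of vs j v] by auto
      moreover have "t (vs[j := v], vs ! j) = (vs, v)"
        using True j r_vj by (simp add: t_def flip: j_def)
      moreover have "p (vs ! j # vs[j := v]) = inv (p (v # vs))"
        using chains_transpose[OF p, of "[]" "vs ! j" "take j vs" v "drop (Suc j) vs"] j
        by (simp add: upd_conv_take_nth_drop flip: id_take_nth_drop)
      moreover have "p (v # vs) = \<one>" if "vs ! j = v"
        using that j nth_mem[OF j(1)]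
        by (intro chains_support[OF p]) (auto simp: ordered_simplices_def)
      ultimately show ?thesis
        unfolding \<open>q = (vs, v)\<close> tq by (auto simp: S_def)
    next
      case False
      then have tq: "t q = q" and "r v = y"
        using v r by (auto simp: t_def)
      have "set ys = r ` set vs"
        using vs by (metis list.set_map)
      then have "set (y # ys) \<subseteq> r ` set (v # vs)"
        using \<open>r v = y\<close> by auto
      then have "p (v # vs) = \<one>"
        using K by (intro chains_support[OF p]) (auto simp: ordered_simplices_def)
      then show ?thesis
        using tq q by simp
    qed
    then show "t q \<in> S \<times> V" "t (t q) = q"
      "p (snd (t q) # fst (t q)) = inv (p (snd q # fst q))"
      "t q = q \<Longrightarrow> p (snd q # fst q) = \<one>"
      by auto
  qed (use finS V chains_closed[OF p] in auto)
  finally show False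
    using val_e e1 eq by simp
qed

section \<open>Comparison with the homology groups\<close>

lemma boundary_map_restrict:
  assumes X: "finite_complex X" and c: "c \<in> chains X (Suc n)"
  shows "boundary_map G X n (restrict c (ordered_simplices X (Suc n)))
    = restrict (bd (vertices X) c) (ordered_simplices X n)"
proof
  fix ws
  have fin: "finite (vertices X)"
    using X by (auto simp: finite_complex_def vertices_def)
  have "(\<Otimes>v\<in>{v. v # ws \<in> ordered_simplices X (Suc n)}. c (v # ws)) = bd (vertices X) c ws"
    unfolding bd_def
    by (rule finprod_mono_neutral_cong_left[OF fin])
       (auto simp: ordered_simplices_def vertices_def chains_closed[OF c] intro!: chains_support[OF c])
  moreover have "(\<Otimes>v\<in>{v. v # ws \<in> ordered_simplices X (Suc n)}.
      restrict c (ordered_simplices X (Suc n)) (v # ws))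
    = (\<Otimes>v\<in>{v. v # ws \<in> ordered_simplices X (Suc n)}. c (v # ws))"
    by (rule finprod_cong') (auto simp: chains_closed[OF c])
  ultimately show "boundary_map G X n (restrict c (ordered_simplices X (Suc n))) ws
      = restrict (bd (vertices X) c) (ordered_simplices X n) ws"
    by (simp add: boundary_map_def)
qed

text \<open>One inclusion extends a chain by \<open>\<one>\<close> and uses the sign rule at
  neighbouring positions only; the other needs arbitrary positions, hence
  \<open>chains_transpose\<close>.\<close>

lemma carrier_chain_group:
  "carrier (chain_group G X n) = (\<lambda>c. restrict c (ordered_simplices X n)) ` chains X n"
proof (intro equalityI subsetI)
  fix c assume "c \<in> carrier (chain_group G X n)"
  then have c: "c \<in> (\<Pi>\<^sub>E vs\<in>ordered_simplices X n. carrier G)" "alternating G X n c"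
    by (auto simp: chain_group_def)
  define c' where "c' vs = (if vs \<in> ordered_simplices X n then c vs else \<one>)" for vs
  have "c' \<in> chains X n"
  proof (rule chainsI)
    fix us vs :: "'c list" and a b
    assume *: "us @ a # b # vs \<in> ordered_simplices X n"
    then have **: "us @ b # a # vs \<in> ordered_simplices X n"
      by (simp only: ordered_simplices_swap)
    have "length us < Suc (length us) \<and> Suc (length us) < n"
      using * by (simp add: ordered_simplices_def)
    then have "c ((us @ b # a # vs)[length us := (us @ b # a # vs) ! Suc (length us),
        Suc (length us) := (us @ b # a # vs) ! length us]) = inv (c (us @ b # a # vs))"
      using c(2) ** unfolding alternating_def by blast
    then show "c' (us @ a # b # vs) = inv (c' (us @ b # a # vs))"
      using * ** by (simp add: c'_def list_update_append nth_append)
  qed (use c in \<open>auto simp: c'_def\<close>)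
  moreover have "c = restrict c' (ordered_simplices X n)"
    using c(1) by (auto simp: c'_def PiE_def extensional_def)
  ultimately show "c \<in> (\<lambda>c. restrict c (ordered_simplices X n)) ` chains X n"
    by blast
next
  fix c' assume "c' \<in> (\<lambda>c. restrict c (ordered_simplices X n)) ` chains X n"
  then obtain c where c: "c \<in> chains X n" and c': "c' = restrict c (ordered_simplices X n)"
    by blast
  have "alternating G X n c'"
    unfolding alternating_def
  proof (intro ballI allI impI)
    fix vs i j
    assume vs: "vs \<in> ordered_simplices X n" and ij: "i < j \<and> j < n"
    define us ms ws where "us = take i vs" and "ms = take (j - Suc i) (drop (Suc i) vs)"
      and "ws = drop (Suc j) vs"
    have len: "length vs = n"
      using vs by (simp add: ordered_simplices_def)
    have split: "vs = us @ vs ! i # ms @ vs ! j # ws"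
    proof -
      have "drop (Suc i) vs = ms @ vs ! j # ws"
        using id_take_nth_drop[of "j - Suc i" "drop (Suc i) vs"] ij len
        by (simp add: ms_def ws_def diff_less_mono)
      then show ?thesis
        using id_take_nth_drop[of i vs] ij len by (simp add: us_def)
    qed
    have lens: "length us = i" "length ms = j - Suc i"
      using ij len by (auto simp: us_def ms_def)
    obtain a b where ab: "vs ! i = a" "vs ! j = b"
      by blast
    note split = split[unfolded ab]
    have upd: "vs[i := b, j := a] = us @ b # ms @ a # ws"
    proof -
      have "(us @ a # ms @ b # ws)[i := b, j := a] = us @ b # ms @ a # ws"
        using lens ij by (auto simp: list_update_append nth_append split: nat.split)
      then show ?thesis
        by (simp only: split[symmetric])
    qed
    have "us @ b # ms @ a # ws \<in> ordered_simplices X n"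
      using vs by (subst (asm) split) (auto simp: ordered_simplices_def insert_commute)
    moreover have "c (us @ b # ms @ a # ws) = inv (c vs)"
      using chains_transpose[OF c, of us b ms a ws] by (simp only: split[symmetric])
    ultimately show "c' (vs[i := vs ! j, j := vs ! i]) = inv (c' vs)"
      using vs unfolding ab upd by (simp add: c')
  qed
  then show "c' \<in> carrier (chain_group G X n)"
    by (auto simp: chain_group_def c' chains_closed[OF c])
qed

lemma restrict_eq_chains_iff:
  assumes c: "c \<in> chains X n" and c': "c' \<in> chains X n"
  shows "restrict c (ordered_simplices X n) = restrict c' (ordered_simplices X n) \<longleftrightarrow> c = c'"
proof
  assume eq: "restrict c (ordered_simplices X n) = restrict c' (ordered_simplices X n)"
  show "c = c'"
  proof
    fix vs
    show "c vs = c' vs"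
      using fun_cong[OF eq, of vs] chains_support[OF c, of vs] chains_support[OF c', of vs]
      by (cases "vs \<in> ordered_simplices X n") auto
  qed
qed simp

text \<open>Restriction to the ordered simplices is injective on \<open>chains\<close>, so it
  identifies cycles and boundaries with the kernel and image of \<open>bd\<close>. The quotient is
  trivial exactly if every coset is the subgroup of boundaries, that is, if every cycle
  bounds.\<close>

lemma reduced_homology_nontrivial_iff:
  assumes X: "finite_complex X"
  shows "carrier (reduced_homology G X k) \<noteq> {\<one>\<^bsub>reduced_homology G X k\<^esub>} \<longleftrightarrow>
    (\<exists>z\<in>chains X (Suc k). bd (vertices X) z = (\<lambda>_. \<one>) \<and>
       (\<forall>p\<in>chains X (Suc (Suc k)). bd (vertices X) p \<noteq> z))"
proof -
  define V where "V = vertices X"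
  define M where "M = (chain_group G X (Suc k))\<lparr>carrier := cycles G X k\<rparr>"
  define R where "R c = restrict c (ordered_simplices X (Suc k))" for c :: "'c list \<Rightarrow> 'a"
  define Z where "Z = {z \<in> chains X (Suc k). bd V z = (\<lambda>_. \<one>)}"
  have down: "\<sigma> \<in> X \<Longrightarrow> \<tau> \<subseteq> \<sigma> \<Longrightarrow> \<tau> \<in> X" for \<sigma> \<tau>
    using X by (auto simp: finite_complex_def)
  have bdX: "bd V c \<in> chains X n" if "c \<in> chains X (Suc n)" for c n
    using bd_chains[OF that] down by blast
  have one: "\<one>\<^bsub>chain_group G X n\<^esub> = restrict (\<lambda>_. \<one>) (ordered_simplices X n)" for n
    by (simp add: chain_group_def)
  have "boundary_map G X k (R c) = \<one>\<^bsub>chain_group G X k\<^esub> \<longleftrightarrow> bd V c = (\<lambda>_. \<one>)"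
    if "c \<in> chains X (Suc k)" for c
    unfolding R_def one boundary_map_restrict[OF X that] V_def[symmetric]
    by (rule restrict_eq_chains_iff[OF bdX[OF that] chains_one])
  then have cyc: "cycles G X k = R ` Z"
    unfolding cycles_def kernel_def carrier_chain_group Z_def R_def[symmetric] by blast
  have bdr: "boundaries G X k = R ` bd V ` chains X (Suc (Suc k))"
    unfolding boundaries_def carrier_chain_group R_def V_def
    using boundary_map_restrict[OF X] by (auto simp: image_image)
  have mult: "R c \<otimes>\<^bsub>M\<^esub> R c' = R (\<lambda>vs. c vs \<otimes> c' vs)" for c c'
    by (auto simp: M_def R_def chain_group_def)
  have coset: "r_coset M (boundaries G X k) (R z)
      = R ` (\<lambda>p vs. bd V p vs \<otimes> z vs) ` chains X (Suc (Suc k))" for z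
    unfolding r_coset_def bdr by (auto simp: mult image_image)
  have rh: "carrier (reduced_homology G X k) = (\<lambda>z. r_coset M (boundaries G X k) (R z)) ` Z"
    unfolding reduced_homology_def M_def[symmetric] carrier_FactGroup
    by (simp add: M_def cyc image_image)
  have rh1: "\<one>\<^bsub>reduced_homology G X k\<^esub> = boundaries G X k"
    by (simp add: reduced_homology_def)
  \<comment> \<open>As \<open>Z\<close> is nonempty, its image is a singleton exactly if the map
    takes that one value throughout.\<close>
  have "(\<lambda>_. \<one>) \<in> Z"
    using chains_one by (auto simp: Z_def bd_def)
  then have img: "f ` Z = {b} \<longleftrightarrow> (\<forall>z\<in>Z. f z = b)" for f and b :: "('c list \<Rightarrow> 'a) set"
    by blast
  have "r_coset M (boundaries G X k) (R z) = boundaries G X k \<longleftrightarrow>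
      z \<in> bd V ` chains X (Suc (Suc k))" if "z \<in> Z" for z
  proof
    have z: "z \<in> chains X (Suc k)"
      using that by (simp add: Z_def)
    assume eq: "r_coset M (boundaries G X k) (R z) = boundaries G X k"
    \<comment> \<open>Writing \<open>z\<close> as a trivial boundary times \<open>z\<close> places
      \<open>R z\<close> in its own coset.\<close>
    have "z = (\<lambda>vs. bd V (\<lambda>_. \<one>) vs \<otimes> z vs)"
      by (simp add: bd_def chains_closed[OF z])
    then have "z \<in> (\<lambda>p vs. bd V p vs \<otimes> z vs) ` chains X (Suc (Suc k))"
      by (rule image_eqI[OF _ chains_one])
    then have "R z \<in> r_coset M (boundaries G X k) (R z)"
      unfolding coset by (rule imageI)
    then have "R z \<in> boundaries G X k"
      by (simp only: eq)
    then obtain p where "p \<in> chains X (Suc (Suc k))" "R z = R (bd V p)"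
      unfolding bdr by blast
    then show "z \<in> bd V ` chains X (Suc (Suc k))"
      using restrict_eq_chains_iff[OF z bdX] by (auto simp: R_def)
  next
    assume "z \<in> bd V ` chains X (Suc (Suc k))"
    then obtain q where q: "q \<in> chains X (Suc (Suc k))" and z: "z = bd V q"
      by blast
    have "(\<lambda>vs. bd V p vs \<otimes> z vs) \<in> bd V ` chains X (Suc (Suc k))"
      if "p \<in> chains X (Suc (Suc k))" for p
      using chains_mult[OF that q] bd_mult[OF that q, of V] z
      by (intro image_eqI[of _ _ "\<lambda>vs. p vs \<otimes> q vs"]) auto
    moreover have "bd V p \<in> (\<lambda>p vs. bd V p vs \<otimes> z vs) ` chains X (Suc (Suc k))"
      if p: "p \<in> chains X (Suc (Suc k))" for p
    proof (rule image_eqI)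
      show "(\<lambda>vs. p vs \<otimes> inv (q vs)) \<in> chains X (Suc (Suc k))"
        by (intro chains_mult chains_inv p q)
      show "bd V p = (\<lambda>vs. bd V (\<lambda>vs. p vs \<otimes> inv (q vs)) vs \<otimes> z vs)"
        using bd_mult[OF p chains_inv[OF q], of V] bd_inv[OF q, of V]
          bd_closed[OF p, of V] bd_closed[OF q, of V]
        by (simp add: z m_assoc)
    qed
    ultimately have "(\<lambda>p vs. bd V p vs \<otimes> z vs) ` chains X (Suc (Suc k)) = bd V ` chains X (Suc (Suc k))"
      by blast
    then show "r_coset M (boundaries G X k) (R z) = boundaries G X k"
      unfolding coset by (simp add: bdr)
  qed
  then have "carrier (reduced_homology G X k) = {\<one>\<^bsub>reduced_homology G X k\<^esub>} \<longleftrightarrow>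
      (\<forall>z\<in>Z. z \<in> bd V ` chains X (Suc (Suc k)))"
    unfolding rh rh1 by (subst img) simp
  then show ?thesis
    unfolding V_def[symmetric] by (auto simp: Z_def)
qed

section \<open>The lower bound\<close>

lemma card_vertices_ge:
  assumes X: "finite_complex X" and pure: "pure_dim d X"
    and hom: "carrier (reduced_homology G X k) \<noteq> {\<one>\<^bsub>reduced_homology G X k\<^esub>}"
  shows "(d + 1) * (k + 2) \<le> card (vertices X) * (k + 1)"
proof (rule ccontr)
  assume less: "\<not> ?thesis"
  define V where "V = vertices X"
  define I where "I = {\<tau> \<in> X. card \<tau> = d + 1}"
  have fin: "finite I" "finite V"
    using X by (auto simp: I_def V_def finite_complex_def vertices_def)
  have I_V: "\<tau> \<subseteq> V" if "\<tau> \<in> I" for \<tau>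
    using that by (auto simp: I_def V_def vertices_def)
  \<comment> \<open>Purity presents \<open>X\<close> as a union of full simplices, the form that
    \<open>acyclic_if_intersecting\<close> treats.\<close>
  have X_eq: "X = (\<Union>\<tau>\<in>I. Pow \<tau>)"
    using X pure by (fastforce simp: I_def finite_complex_def pure_dim_def)
  have "I \<noteq> {}"
    using X X_eq by (auto simp: finite_complex_def)
  then have "d + 1 \<le> card V"
    using card_mono[OF fin(2) I_V] by (auto simp: I_def)
  \<comment> \<open>The number of vertices missed by each facet.\<close>
  then obtain m where m: "card V = d + 1 + m"
    using le_Suc_ex by blast
  have "\<Inter>S \<noteq> {}" if S: "S \<subseteq> I" "S \<noteq> {}" "card S \<le> Suc (Suc k)" for S
  proof
    assume "\<Inter>S = {}"
    then have "V = (\<Union>\<tau>\<in>S. V - \<tau>)"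
      using S(2) by blast
    then have "card V \<le> (\<Sum>\<tau>\<in>S. card (V - \<tau>))"
      using card_UN_le[of S "\<lambda>\<tau>. V - \<tau>"] S fin finite_subset by fastforce
    also have "\<dots> = (\<Sum>\<tau>\<in>S. m)"
    proof (rule sum.cong)
      fix \<tau> assume "\<tau> \<in> S"
      then have "\<tau> \<subseteq> V" "card \<tau> = d + 1"
        using S I_V by (auto simp: I_def)
      then show "card (V - \<tau>) = m"
        using m fin finite_subset by (subst card_Diff_subset) auto
    qed simp
    also have "\<dots> \<le> (k + 2) * m"
      using mult_le_mono1[OF S(3), of m] by simp
    finally have "d + 1 \<le> m * (k + 1)"
      using m by (simp add: algebra_simps)
    then have "(d + 1) * (k + 2) \<le> card V * (k + 1)"
      using m by (simp add: algebra_simps)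
    then show False
      using less by (simp add: V_def)
  qed
  then have "\<exists>p\<in>chains X (Suc (Suc k)). bd V p = z"
    if "z \<in> chains X (Suc k)" "bd V z = (\<lambda>_. \<one>)" for z
    using acyclic_if_intersecting[of I V "\<lambda>\<tau>. \<tau>" "Suc k" z] fin \<open>I \<noteq> {}\<close> I_V that
    unfolding X_eq[symmetric] by simp
  then show False
    using hom unfolding reduced_homology_nontrivial_iff[OF X] V_def by blast
qed

section \<open>The extremal complex\<close>

text \<open>Only an upper bound on the vertex set is asserted; the exact number follows in
  \<open>theorem1\<close> from \<open>card_vertices_ge\<close>.\<close>

lemma tight_complex:
  assumes kd: "k \<le> d" and G: "carrier G \<noteq> {\<one>}"
    and n: "(d + 1) * (k + 2) \<le> n * (k + 1)"
  shows "\<exists>X :: nat set set. finite_complex X \<and> pure_dim d X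
    \<and> carrier (reduced_homology G X k) \<noteq> {\<one>\<^bsub>reduced_homology G X k\<^esub>}
    \<and> vertices X \<subseteq> {..<n}"
proof -
  obtain g where g: "g \<in> carrier G" "g \<noteq> \<one>"
    using G by auto
  have "(d + 1) * (k + 1) \<le> n * (k + 1)"
    using n by (simp add: algebra_simps)
  then obtain m where m: "n = d + 1 + m"
    using le_Suc_ex by (metis mult_le_cancel2 add_gr_0 zero_less_one)
  \<comment> \<open>Hence a residue class modulo \<open>k + 2\<close> has at most \<open>m\<close>
    members below \<open>n\<close>, and removing it leaves room for a facet with
    \<open>d + 1\<close> vertices.\<close>
  have nm: "n \<le> (k + 2) * m"
    using n unfolding m by (simp add: algebra_simps)
  \<comment> \<open>Together with \<open>k \<le> d\<close> this gives \<open>k + 1 < n\<close>, so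
    the vertices \<open>0, ..., k + 1\<close> are available.\<close>
  have "m > 0"
    using nm m by (cases m) auto
  have "\<exists>F. {..k + 1} - {i} \<subseteq> F \<and> F \<subseteq> {..<n} - {v. v mod (k + 2) = i} \<and> card F = d + 1"
    if "i \<le> k + 1" for i
  proof (rule exists_subset_between)
    show "card ({..k + 1} - {i}) \<le> d + 1"
      using that kd by simp
    have "{v. v < n \<and> v mod (k + 2) = i} \<subseteq> (\<lambda>q. q * (k + 2) + i) ` {..<m}"
    proof
      fix v assume "v \<in> {v. v < n \<and> v mod (k + 2) = i}"
      then have "v = v div (k + 2) * (k + 2) + i" "v < m * (k + 2)"
        using nm div_mult_mod_eq[of v "k + 2"] by (auto simp: mult.commute)
      then have "v = v div (k + 2) * (k + 2) + i" "v div (k + 2) < m"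
        using less_mult_imp_div_less by blast+
      then show "v \<in> (\<lambda>q. q * (k + 2) + i) ` {..<m}"
        by blast
    qed
    then have "card {v. v < n \<and> v mod (k + 2) = i} \<le> m"
      using surj_card_le[OF finite_lessThan] by (metis card_lessThan)
    moreover have "{..<n} - {v. v mod (k + 2) = i} = {..<n} - {v. v < n \<and> v mod (k + 2) = i}"
      by auto
    ultimately show "d + 1 \<le> card ({..<n} - {v. v mod (k + 2) = i})"
      using m diff_card_le_card_Diff[of "{v. v < n \<and> v mod (k + 2) = i}" "{..<n}"] by simp
    show "{..k + 1} - {i} \<subseteq> {..<n} - {v. v mod (k + 2) = i}"
      using kd m \<open>m > 0\<close> by auto
  qed simp
  then obtain F where F: "\<And>i. i \<le> k + 1 \<Longrightarrow> {..k + 1} - {i} \<subseteq> F i"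
    "\<And>i. i \<le> k + 1 \<Longrightarrow> F i \<subseteq> {..<n} - {v. v mod (k + 2) = i}"
    "\<And>i. i \<le> k + 1 \<Longrightarrow> card (F i) = d + 1"
    by metis
  define X where "X = (\<Union>i\<in>{..k + 1}. Pow (F i))"
  define V where "V = vertices X"
  have V_eq: "V = (\<Union>i\<in>{..k + 1}. F i)"
    by (auto simp: V_def X_def vertices_def)
  have finF: "finite (F i)" if "i \<le> k + 1" for i
    using F(2)[OF that] finite_subset by blast
  have V_n: "V \<subseteq> {..<n}"
    using F(2) unfolding V_eq by fastforce
  have X: "finite_complex X"
    using finF by (auto simp: finite_complex_def X_def intro: finite_subset)
  have pure: "pure_dim d X"
    unfolding pure_dim_def
  proof
    fix \<sigma> assume "\<sigma> \<in> X"
    then obtain i where i: "i \<le> k + 1" "\<sigma> \<subseteq> F i"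
      by (auto simp: X_def)
    then have "F i \<in> X"
      by (auto simp: X_def)
    then show "\<exists>\<tau>\<in>X. \<sigma> \<subseteq> \<tau> \<and> card \<tau> = d + 1"
      using i F(3) by blast
  qed
  define ys where "ys = [1..<k + 2]"
  have ys: "set (0 # ys) = {..k + 1}" "length ys = k + 1" "distinct (0 # ys)"
    by (auto simp: ys_def)
  obtain e where e: "e \<in> chains (Pow (set (0 # ys))) (Suc (length ys))" "e (0 # ys) = g"
    using elementary_chain[OF ys(3) g(1)] by auto
  have "bd V e \<in> chains (Pow (set (0 # ys))) (Suc k)"
    using e(1) unfolding ys by (intro bd_chains) auto
  then have "bd V e \<in> chains X (Suc k)"
  \<comment> \<open>A simplex with \<open>k + 1\<close> vertices is a proper face of
    \<open>{..k + 1}\<close>, so it misses some \<open>i\<close> and lies in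
    \<open>F i\<close>.\<close>
  proof (rule chains_mono)
    fix \<sigma> assume \<sigma>: "\<sigma> \<in> Pow (set (0 # ys))" "card \<sigma> = Suc k"
    then have "\<sigma> \<noteq> {..k + 1}"
      by auto
    then obtain i where "i \<le> k + 1" "\<sigma> \<subseteq> {..k + 1} - {i}"
      using \<sigma> unfolding ys by blast
    then have "i \<in> {..k + 1}" "\<sigma> \<in> Pow (F i)"
      using F(1) by blast+
    then show "\<sigma> \<in> X"
      unfolding X_def by blast
  qed
  moreover have "finite V"
    using V_n finite_subset by blast
  then have "bd V (bd V e) = (\<lambda>_. \<one>)"
    using bd_bd[OF e(1)] by blast
  moreover have "bd V p \<noteq> bd V e" if "p \<in> chains X (Suc (Suc k))" for p
  proof (rule simplex_boundary_not_bounding[where r = "\<lambda>v. v mod (k + 2)" and K = X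
        and ys = ys and y = 0])
    show "set (0 # ys) \<subseteq> V"
    proof
      fix j assume j: "j \<in> set (0 # ys)"
      \<comment> \<open>Any index other than \<open>j\<close> would do: \<open>F i\<close> contains
        every vertex of the small simplex except \<open>i\<close>.\<close>
      define i where "i = (if j = 0 then 1 else 0 :: nat)"
      have "i \<le> k + 1" "j \<in> {..k + 1} - {i}"
        using j unfolding ys by (auto simp: i_def)
      then show "j \<in> V"
        using F(1) unfolding V_eq by blast
    qed
    show "\<not> set (0 # ys) \<subseteq> (\<lambda>v. v mod (k + 2)) ` \<sigma>" if \<sigma>: "\<sigma> \<in> X" for \<sigma>
    proof -
      obtain i where "i \<le> k + 1" "\<sigma> \<subseteq> F i"
        using \<sigma> by (auto simp: X_def)
      then have "i \<notin> (\<lambda>v. v mod (k + 2)) ` \<sigma>"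
        using F(2) by blast
      then show ?thesis
        using \<open>i \<le> k + 1\<close> unfolding ys by blast
    qed
    show "(\<lambda>v. v mod (k + 2)) ` V \<subseteq> set (0 # ys)"
      unfolding ys using mod_less_divisor[of "k + 2"] by (auto simp: less_Suc_eq_le)
    show "x mod (k + 2) = x" if "x \<in> set (0 # ys)" for x
      using that unfolding ys by simp
  qed (use \<open>finite V\<close> e g that ys in auto)
  ultimately have "carrier (reduced_homology G X k) \<noteq> {\<one>\<^bsub>reduced_homology G X k\<^esub>}"
    unfolding reduced_homology_nontrivial_iff[OF X] V_def[symmetric] by blast
  then show ?thesis
    using X pure V_n V_def by blast
qed

end

section \<open>Rounding up and conclusion\<close>

lemma ceiling_divide_le_iff:
  fixes a b n :: nat
  assumes "b > 0"
  shows "\<lceil>real a / real b\<rceil> \<le> int n \<longleftrightarrow> a \<le> n * b"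
proof -
  have "\<lceil>real a / real b\<rceil> \<le> int n \<longleftrightarrow> real a \<le> real (n * b)"
    using assms by (simp add: ceiling_le_iff divide_le_eq)
  then show ?thesis
    by (simp only: of_nat_le_iff)
qed

theorem theorem1:
  fixes d k :: nat and G :: "('g, 'm) monoid_scheme"
  assumes "k \<le> d" and "comm_group G"
  shows "(\<forall>X :: 'a set set.
            finite_complex X \<and> pure_dim d X
              \<and> carrier (reduced_homology G X k) \<noteq> {\<one>\<^bsub>reduced_homology G X k\<^esub>}
            \<longrightarrow> int (card (vertices X)) \<ge> \<lceil>real ((d + 1) * (k + 2)) / real (k + 1)\<rceil>)
       \<and> (carrier G \<noteq> {\<one>\<^bsub>G\<^esub>} \<longrightarrow>
           (\<exists>X :: nat set set.
              finite_complex X \<and> pure_dim d X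
              \<and> carrier (reduced_homology G X k) \<noteq> {\<one>\<^bsub>reduced_homology G X k\<^esub>}
              \<and> int (card (vertices X)) = \<lceil>real ((d + 1) * (k + 2)) / real (k + 1)\<rceil>))"
proof -
  interpret comm_group G by (rule assms(2))
  define n where "n = nat \<lceil>real ((d + 1) * (k + 2)) / real (k + 1)\<rceil>"
  have "real ((d + 1) * (k + 2)) / real (k + 1) \<ge> 0"
    by simp
  then have n: "int n = \<lceil>real ((d + 1) * (k + 2)) / real (k + 1)\<rceil>"
    unfolding n_def by (metis ceiling_mono ceiling_zero nat_0_le)
  have "\<exists>X :: nat set set. finite_complex X \<and> pure_dim d X
      \<and> carrier (reduced_homology G X k) \<noteq> {\<one>\<^bsub>reduced_homology G X k\<^esub>}
      \<and> int (card (vertices X)) = \<lceil>real ((d + 1) * (k + 2)) / real (k + 1)\<rceil>"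
    if G: "carrier G \<noteq> {\<one>\<^bsub>G\<^esub>}"
  proof -
    have "(d + 1) * (k + 2) \<le> n * (k + 1)"
      using ceiling_divide_le_iff[of "k + 1" "(d + 1) * (k + 2)" n] n by simp
    from tight_complex[OF assms(1) G this]
    obtain X :: "nat set set" where X: "finite_complex X" "pure_dim d X"
      "carrier (reduced_homology G X k) \<noteq> {\<one>\<^bsub>reduced_homology G X k\<^esub>}" "vertices X \<subseteq> {..<n}"
      by blast
    have "card (vertices X) \<le> n"
      using card_mono[OF _ X(4)] by simp
    \<comment> \<open>Applied to the constructed complex, the lower bound turns the inclusion in
      \<open>{..<n}\<close> into the exact count.\<close>
    moreover have "(d + 1) * (k + 2) \<le> card (vertices X) * (k + 1)"
      by (rule card_vertices_ge[OF X(1-3)])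
    then have "int n \<le> int (card (vertices X))"
      unfolding n by (subst ceiling_divide_le_iff) auto
    ultimately show ?thesis
      using X n by auto
  qed
  moreover have "\<lceil>real ((d + 1) * (k + 2)) / real (k + 1)\<rceil> \<le> int (card (vertices X))"
    if "finite_complex X" "pure_dim d X"
      "carrier (reduced_homology G X k) \<noteq> {\<one>\<^bsub>reduced_homology G X k\<^esub>}"
    for X :: "'a set set"
    using card_vertices_ge[OF that] by (subst ceiling_divide_le_iff) auto
  ultimately show ?thesis
    by blast
qed

end
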